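(* For any $w\in S_n$, the left weak order interval $\Lambda_{w\oplus w^{-1}}$ (in $S_{2n}$) is rank-symmetric. It follows that there are at least $\left(\lfloor\frac{n}{2}\rfloor\right)!$ permutations $w$ in $S_n$ such that $\Lambda_w$ is rank-symmetric.
   Context: Here $n$ is a positive integer and $S_m$ is the symmetric group on $[m]=\{1,\ldots,m\}$, with product $(uv)(k)=u(v(k))$; permutations are written in one-line notation $w=w_1\cdots w_m$ with $w_i=w(i)$. For $w\in S_m$, $\mathrm{Inv}(w)=\{(i,j)\in[m]\times[m] : i<j \text{ and } w(i)>w(j)\}$ and $\ell(w)=|\mathrm{Inv}(w)|$. The left weak order $\leq_L$ on $S_m$ is the (reflexive) transitive closure of the relations $v\leq_L w$ whenever $w=s_iv$ and $\ell(w)=\ell(v)+1$, where $s_i=(i\;\;i+1)$ is an adjacent transposition. It is a ranked poset with rank function $\ell$. Write $\Lambda_w=\{v\in S_m : v\leq_L w\}=[\mathrm{id},w]$, ordered by $\leq_L$. For $v=v_1\cdots v_m\in S_m$ and $w=w_1\cdots w_n\in S_n$, $v\oplus w\in S_{m+n}$ is the permutation $v_1\cdots v_m(w_1+m)(w_2+m)\cdots(w_n+m)$. A poset $P$ is ranked if there is $\rho:P\to\mathbb{N}=\{0,1,2,\ldots\}$ with $\rho(x)=0$ for minimal $x$ and $\rho(y)=\rho(x)+1$ whenever $y$ covers $x$; for finite ranked $P$, $F(P,q)=\sum_{x\in P}q^{\rho(x)}$. A polynomial is symmetric if its coefficients read left to right are the same as when read right to left; for a polynomial $f$ with nonzero constant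 term this means $f(q)=q^{\deg f}f(1/q)$. A finite ranked poset $P$ is rank-symmetric if $F(P,q)$ is symmetric. *)

theory Defs
  imports "HOL-Combinatorics.Permutations" "HOL-Computational_Algebra.Polynomial"
begin

section \<open>Ranked posets\<close>

text \<open>A poset is given by a carrier \<open>P\<close> and a relation \<open>r\<close> such that
  \<^term>\<open>partial_order_on P r\<close>; a pair \<open>(x, y) \<in> r\<close> means that \<open>x\<close> is below or equal to \<open>y\<close>.\<close>

definition minimal_in :: "'a set \<Rightarrow> 'a rel \<Rightarrow> 'a \<Rightarrow> bool" where
  "minimal_in P r x \<longleftrightarrow> x \<in> P \<and> (\<forall>y\<in>P. (y, x) \<in> r \<longrightarrow> y = x)"

text \<open>\<open>covered_by P r x y\<close> reads: \<open>y\<close> covers \<open>x\<close>.\<close>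

definition covered_by :: "'a set \<Rightarrow> 'a rel \<Rightarrow> 'a \<Rightarrow> 'a \<Rightarrow> bool" where
  "covered_by P r x y \<longleftrightarrow> x \<in> P \<and> y \<in> P \<and> (x, y) \<in> r \<and> x \<noteq> y \<and>
     (\<forall>z\<in>P. (x, z) \<in> r \<and> (z, y) \<in> r \<longrightarrow> z = x \<or> z = y)"

definition rank_function :: "'a set \<Rightarrow> 'a rel \<Rightarrow> ('a \<Rightarrow> nat) \<Rightarrow> bool" where
  "rank_function P r \<rho> \<longleftrightarrow> (\<forall>x. minimal_in P r x \<longrightarrow> \<rho> x = 0) \<and>
     (\<forall>x y. covered_by P r x y \<longrightarrow> \<rho> y = \<rho> x + 1)"

definition rank_poly :: "'a set \<Rightarrow> ('a \<Rightarrow> nat) \<Rightarrow> int poly" where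
  "rank_poly P \<rho> = (\<Sum>x\<in>P. monom 1 (\<rho> x))"

text \<open>The coefficient list runs from the constant term to the leading coefficient, so a
  polynomial with zero constant term is symmetric only if it is \<open>0\<close>. Rank polynomials of
  nonempty finite ranked posets have nonzero constant term.\<close>

definition symmetric_poly :: "'a::zero poly \<Rightarrow> bool" where
  "symmetric_poly f \<longleftrightarrow> rev (coeffs f) = coeffs f"

text \<open>The choice of \<open>\<rho>\<close> is immaterial: a finite poset has at most one rank function, see
  \<open>rank_function_unique\<close> below.\<close>

definition rank_symmetric :: "'a set \<Rightarrow> 'a rel \<Rightarrow> bool" where
  "rank_symmetric P r \<longleftrightarrow> finite P \<and> partial_order_on P r \<and>
     (\<exists>\<rho>. rank_function P r \<rho> \<and> symmetric_poly (rank_poly P \<rho>))"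

lemma rank_function_unique:
  assumes fin: "finite P" and po: "partial_order_on P r"
    and \<rho>: "rank_function P r \<rho>" and \<sigma>: "rank_function P r \<sigma>" and "x \<in> P"
  shows "\<rho> x = \<sigma> x"
proof -
  have tr: "trans r" and an: "antisym r" and rf: "refl_on P r"
    using po by (auto simp: partial_order_on_def preorder_on_def)
  define D where "D x = {y \<in> P. (y, x) \<in> r \<and> y \<noteq> x}" for x
  have finD: "finite (D x)" for x unfolding D_def using fin by simp
  have less: "card (D y) < card (D x)" if "y \<in> D x" for x y
  proof (rule psubset_card_mono[OF finD])
    show "D y \<subset> D x"
      using that an transD[OF tr] unfolding D_def by (auto dest: antisymD)
  qed
  show ?thesis using \<open>x \<in> P\<close>
  proof (induction "card (D x)" arbitrary: x rule: less_induct)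
    case less': less
    show ?case
    proof (cases "D x = {}")
      case True
      then have "minimal_in P r x" using less'.prems by (auto simp: minimal_in_def D_def)
      then show ?thesis using \<rho> \<sigma> by (simp add: rank_function_def)
    next
      case False
      then have "Max ((\<lambda>y. card (D y)) ` D x) \<in> (\<lambda>y. card (D y)) ` D x"
        using finD by (intro Max_in) auto
      then obtain y where y: "y \<in> D x" and "card (D y) = Max ((\<lambda>y. card (D y)) ` D x)" by auto
      then have mx: "card (D z) \<le> card (D y)" if "z \<in> D x" for z
        using finD that by simp
      have "covered_by P r y x"
        unfolding covered_by_def
      proof (intro conjI ballI impI)
        fix z assume "z \<in> P" and z: "(y, z) \<in> r \<and> (z, x) \<in> r"
        show "z = y \<or> z = x"
        proof (rule ccontr)
          assume "\<not> (z = y \<or> z = x)"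
          then have "z \<in> D x" "y \<in> D z" using y z \<open>z \<in> P\<close> by (auto simp: D_def)
          then show False using mx less by (meson not_less)
        qed
      qed (use y less'.prems in \<open>auto simp: D_def\<close>)
      moreover have "\<rho> y = \<sigma> y" using less'.hyps[OF less[OF y]] y by (simp add: D_def)
      ultimately show ?thesis using \<rho> \<sigma> by (simp add: rank_function_def)
    qed
  qed
qed

section \<open>The left weak order\<close>

text \<open>Elements of $S_m$ are functions \<open>w\<close> on \<open>nat\<close> with \<open>w permutes {1..m}\<close>, i.e. they fix
  everything outside \<open>{1..m}\<close>; the product is \<open>\<circ>\<close>.\<close>

definition Inv :: "nat \<Rightarrow> (nat \<Rightarrow> nat) \<Rightarrow> (nat \<times> nat) set" where
  "Inv m w = {(i, j) \<in> {1..m} \<times> {1..m}. i < j \<and> w i > w j}"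

definition len :: "nat \<Rightarrow> (nat \<Rightarrow> nat) \<Rightarrow> nat" where
  "len m w = card (Inv m w)"

definition left_weak_step :: "nat \<Rightarrow> (nat \<Rightarrow> nat) rel" where
  "left_weak_step m = {(v, w). v permutes {1..m} \<and> w permutes {1..m} \<and>
     (\<exists>i\<in>{1..<m}. w = transpose i (i + 1) \<circ> v) \<and> len m w = len m v + 1}"

text \<open>The restriction is needed because \<open>\<^sup>*\<close> relates every function on \<open>nat\<close> to itself.\<close>

definition left_weak_order :: "nat \<Rightarrow> (nat \<Rightarrow> nat) rel" where
  "left_weak_order m = Restr ((left_weak_step m)\<^sup>*) {w. w permutes {1..m}}"

definition weak_interval :: "nat \<Rightarrow> (nat \<Rightarrow> nat) \<Rightarrow> (nat \<Rightarrow> nat) set" where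
  "weak_interval m w = {v. v permutes {1..m} \<and> (v, w) \<in> left_weak_order m}"

definition weak_interval_rank_symmetric :: "nat \<Rightarrow> (nat \<Rightarrow> nat) \<Rightarrow> bool" where
  "weak_interval_rank_symmetric m w \<longleftrightarrow>
     rank_symmetric (weak_interval m w) (Restr (left_weak_order m) (weak_interval m w))"

text \<open>For \<open>v\<close> in $S_m$ and \<open>w\<close> in $S_n$ this is an element of $S_{m+n}$: both \<open>v\<close> and \<open>w\<close> fix \<open>0\<close>
  and \<open>w\<close> fixes everything above \<open>n\<close>.\<close>

definition perm_oplus :: "nat \<Rightarrow> (nat \<Rightarrow> nat) \<Rightarrow> (nat \<Rightarrow> nat) \<Rightarrow> nat \<Rightarrow> nat" where
  "perm_oplus m v w k = (if k \<le> m then v k else w (k - m) + m)"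

lemma perm_oplus_permutes:
  assumes v: "v permutes {1..m}" and w: "w permutes {1..n}"
  shows "perm_oplus m v w permutes {1..m + n}"
proof (rule bij_imp_permutes)
  show "perm_oplus m v w k = k" if "k \<notin> {1..m + n}" for k
  proof (cases "k \<le> m")
    case True
    then show ?thesis using that permutes_not_in[OF v, of k] by (auto simp: perm_oplus_def)
  next
    case False
    then have "k - m \<notin> {1..n}" using that by auto
    then show ?thesis using False permutes_not_in[OF w, of "k - m"] by (auto simp: perm_oplus_def)
  qed
  have v_in: "v k \<in> {1..m}" if "k \<in> {1..m}" for k using permutes_in_image[OF v] that by blast
  have w_in: "w k \<in> {1..n}" if "k \<in> {1..n}" for k using permutes_in_image[OF w] that by blast
  have into: "perm_oplus m v w ` {1..m + n} \<subseteq> {1..m + n}"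
  proof (rule image_subsetI)
    fix k assume k: "k \<in> {1..m + n}"
    show "perm_oplus m v w k \<in> {1..m + n}"
    proof (cases "k \<le> m")
      case True
      then show ?thesis using v_in[of k] k by (simp add: perm_oplus_def)
    next
      case False
      then have "k - m \<in> {1..n}" using k by auto
      then show ?thesis using False w_in[of "k - m"] by (simp add: perm_oplus_def)
    qed
  qed
  have v_le: "v k \<le> m" if "k \<le> m" for k
    using that permutes_in_image[OF v, of k] permutes_not_in[OF v, of k] by (cases "k = 0") auto
  have w_pos: "w (k - m) > 0" if "k > m" for k
    using that permutes_in_image[OF w, of "k - m"] permutes_not_in[OF w, of "k - m"]
    by (cases "k - m \<le> n") auto
  have "inj (perm_oplus m v w)"
  proof (rule injI)
    fix a b assume eq: "perm_oplus m v w a = perm_oplus m v w b"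
    show "a = b"
    proof (cases "a \<le> m"; cases "b \<le> m")
      assume "a \<le> m" "b \<le> m"
      then show ?thesis using eq permutes_inj[OF v] by (auto simp: perm_oplus_def dest: injD)
    next
      assume "\<not> a \<le> m" "\<not> b \<le> m"
      then have "a - m = b - m"
        using eq permutes_inj[OF w] by (auto simp: perm_oplus_def dest: injD)
      then show ?thesis using \<open>\<not> a \<le> m\<close> \<open>\<not> b \<le> m\<close> by simp
    next
      assume "a \<le> m" "\<not> b \<le> m"
      then show ?thesis using eq v_le[of a] w_pos[of b] by (auto simp: perm_oplus_def)
    next
      assume "\<not> a \<le> m" "b \<le> m"
      then show ?thesis using eq v_le[of b] w_pos[of a] by (auto simp: perm_oplus_def)
    qed
  qed
  then have "inj_on (perm_oplus m v w) {1..m + n}" using inj_on_subset by blast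
  with into show "bij_betw (perm_oplus m v w) {1..m + n} {1..m + n}"
    by (simp add: bij_betw_def endo_inj_surj)
qed

end

theory Submission
  imports Defs
begin

text \<open>The left weak order is containment of inversion sets, so an element below
  \<open>x = w \<oplus> w\<^sup>-\<^sup>1\<close> has the form \<open>v = v\<^sub>1 \<oplus> v\<^sub>2\<close> with \<open>v\<^sub>1\<close> below \<open>w\<close> and
  \<open>v\<^sub>2\<close> below \<open>w\<^sup>-\<^sup>1\<close>. Sending it to \<open>v\<^sub>2 w \<oplus> v\<^sub>1 w\<^sup>-\<^sup>1\<close> is an involution of the interval that
  takes length \<open>k\<close> to \<open>\<ell>(x) - k\<close>. With \<open>\<tau>\<close> the permutation exchanging the two blocks, it is
  \<open>v \<mapsto> \<tau> v x\<^sup>-\<^sup>1 \<tau>\<close>, and \<open>\<tau> x \<tau> = x\<^sup>-\<^sup>1\<close>. For the count, \<open>w \<mapsto> w \<oplus> w\<^sup>-\<^sup>1\<close> is injective on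
  \<open>S\<^sub>k\<close>, \<open>k = \<lfloor>n/2\<rfloor>\<close>; for odd \<open>n\<close> the result also fixes the point \<open>n\<close>.\<close>

section \<open>Left weak order as containment of inversion sets\<close>

lemma finite_Inv: "finite (Inv m w)"
  by (rule finite_subset[of _ "{1..m} \<times> {1..m}"]) (auto simp: Inv_def)

lemma InvD:
  assumes "(i, j) \<in> Inv m w"
  shows "i \<in> {1..m}" "j \<in> {1..m}" "i < j" "w i > w j"
  using assms by (auto simp: Inv_def)

text \<open>The exchanged values \<open>i\<close> and \<open>i + 1\<close> are adjacent, so each
  compares in the same way with any third value. Only the pair of positions holding both changes its
  order.\<close>

lemma Inv_transpose:
  assumes v: "v permutes {1..m}" and ab: "a \<in> {1..m}" "b \<in> {1..m}" "a < b"
    and va: "v a = i" and vb: "v b = i + 1"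
  shows "Inv m (transpose i (i + 1) \<circ> v) = insert (a, b) (Inv m v)"
proof -
  have inj: "v c = v d \<longleftrightarrow> c = d" for c d
    using permutes_inj[OF v] by (auto dest: injD)
  have swap: "transpose i (i + 1) (v c) > transpose i (i + 1) (v d) \<longleftrightarrow>
      (c, d) = (a, b) \<or> v c > v d" if "c < d" for c d
  proof -
    have "v c \<noteq> v d" using that inj by auto
    moreover have "v c = i \<longleftrightarrow> c = a" "v d = i \<longleftrightarrow> d = a"
      "v c = i + 1 \<longleftrightarrow> c = b" "v d = i + 1 \<longleftrightarrow> d = b"
      using inj va vb by metis+
    ultimately show ?thesis using that ab va vb
      by (auto simp: transpose_def)
  qed
  show ?thesis unfolding Inv_def using swap ab by auto
qed

lemma left_weak_step_Inv:
  assumes "(v, w) \<in> left_weak_step m"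
  shows "Inv m v \<subseteq> Inv m w"
proof -
  from assms obtain i where v: "v permutes {1..m}" and w: "w permutes {1..m}"
    and i: "i \<in> {1..<m}" and wv: "w = transpose i (i + 1) \<circ> v" and len: "len m w = len m v + 1"
    by (auto simp: left_weak_step_def)
  define a where "a = inv v i"
  define b where "b = inv v (i + 1)"
  have va: "v a = i" and vb: "v b = i + 1"
    unfolding a_def b_def using permutes_inverses(1)[OF v] by auto
  have ab: "a \<in> {1..m}" "b \<in> {1..m}"
    using permutes_in_image[OF v, of a] permutes_in_image[OF v, of b] va vb i by auto
  have "a \<noteq> b" using va vb by auto
  then consider "a < b" | "b < a" by linarith
  then show ?thesis
  proof cases
    case 1
    then show ?thesis using Inv_transpose[OF v ab 1 va vb] wv by auto
  next
    \<comment> \<open>In this order the step would remove the inversion \<open>(b, a)\<close>,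
      against the rise in length.\<close>
    case 2
    have "v = transpose i (i + 1) \<circ> w" by (simp add: wv flip: comp_assoc)
    moreover have "w b = i" "w a = i + 1" by (auto simp: wv va vb)
    ultimately have "Inv m v = insert (b, a) (Inv m w)"
      using Inv_transpose[OF w ab(2,1) 2] by metis
    then have "len m w \<le> len m v"
      unfolding len_def by (metis card_mono finite_Inv subset_insertI)
    then show ?thesis using len by simp
  qed
qed

lemma left_weak_steps_Inv: "(v, w) \<in> (left_weak_step m)\<^sup>* \<Longrightarrow> Inv m v \<subseteq> Inv m w"
  by (induction rule: rtrancl_induct) (auto dest: left_weak_step_Inv)

text \<open>Without descents \<open>u\<close> increases strictly on \<open>{1..m}\<close>, so
  \<open>i \<le> u i\<close> throughout, which only the identity satisfies.\<close>

lemma permutes_descent: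
  fixes u :: "nat \<Rightarrow> nat"
  assumes u: "u permutes {1..m}" and "u \<noteq> id"
  obtains i where "i \<in> {1..<m}" "u i > u (i + 1)"
proof (rule ccontr)
  assume "\<not> thesis"
  with that have le: "u i \<le> u (i + 1)" if "i \<in> {1..<m}" for i
    using \<open>i \<in> {1..<m}\<close> by (meson not_le)
  have lt: "u i < u (i + 1)" if "i \<in> {1..<m}" for i
    using le[OF that] permutes_inj[OF u] by (metis add_cancel_left_right injD le_neq_implies_less zero_neq_one)
  have "i \<le> u i" if "i \<in> {1..m}" for i
    using that
  proof (induction i)
    case (Suc i)
    show ?case
    proof (cases "i = 0")
      case True
      then show ?thesis using permutes_in_image[OF u, of "Suc i"] Suc.prems by auto
    next
      case False
      then show ?thesis using Suc lt[of i] by fastforce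
    qed
  qed simp
  then have "u = id" by (intro permutes_natset_ge[OF u]) auto
  with assms(2) show False by simp
qed

text \<open>Induction on the number of inversions of \<open>w\<close> missing from \<open>v\<close>.
  A descent of \<open>w \<circ> inv v\<close> gives consecutive values of \<open>v\<close> whose
  positions are inverted by \<open>w\<close>; swapping these values adds one missing
  inversion.\<close>

lemma Inv_imp_left_weak_steps:
  assumes "v permutes {1..m}" and w: "w permutes {1..m}" and "Inv m v \<subseteq> Inv m w"
  shows "(v, w) \<in> (left_weak_step m)\<^sup>*"
  using assms(1,3)
proof (induction "card (Inv m w - Inv m v)" arbitrary: v rule: less_induct)
  case less
  note v = less.prems(1) and sub = less.prems(2)
  show ?case
  proof (cases "v = w")
    case False
    have u: "w \<circ> inv v permutes {1..m}"
      by (rule permutes_compose[OF permutes_inv[OF v] w])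
    have "w \<circ> inv v \<noteq> id"
    proof
      assume "w \<circ> inv v = id"
      then have "w \<circ> inv v \<circ> v = v" by simp
      then show False using False permutes_inv_o(2)[OF v] by (simp add: comp_assoc)
    qed
    then obtain i where i: "i \<in> {1..<m}" and desc: "(w \<circ> inv v) i > (w \<circ> inv v) (i + 1)"
      using permutes_descent[OF u] by blast
    define a where "a = inv v i"
    define b where "b = inv v (i + 1)"
    have va: "v a = i" and vb: "v b = i + 1"
      unfolding a_def b_def using permutes_inverses(1)[OF v] by auto
    have ab: "a \<in> {1..m}" "b \<in> {1..m}"
      using permutes_in_image[OF v, of a] permutes_in_image[OF v, of b] va vb i by auto
    have wab: "w a > w b" using desc by (simp add: a_def b_def)
    \<comment> \<open>Otherwise \<open>(b, a)\<close> would be an inversion of \<open>v\<close>,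
      hence of \<open>w\<close>, against \<open>wab\<close>.\<close>
    have "\<not> b < a"
      using sub ab va vb wab by (auto simp: Inv_def)
    moreover have "a \<noteq> b" using va vb by auto
    ultimately have "a < b" by simp
    define z where "z = transpose i (i + 1) \<circ> v"
    have Inv_z: "Inv m z = insert (a, b) (Inv m v)"
      unfolding z_def by (rule Inv_transpose[OF v ab \<open>a < b\<close> va vb])
    have new: "(a, b) \<in> Inv m w" "(a, b) \<notin> Inv m v"
      using ab \<open>a < b\<close> wab va vb by (auto simp: Inv_def)
    have z: "z permutes {1..m}"
      unfolding z_def using i by (intro permutes_compose[OF v] permutes_swap_id) auto
    have "(v, z) \<in> left_weak_step m"
      using v z i new(2) Inv_z finite_Inv[of m v]
      by (auto simp: left_weak_step_def z_def len_def)
    moreover have "(z, w) \<in> (left_weak_step m)\<^sup>*"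
    proof (rule less.hyps[OF _ z])
      show "card (Inv m w - Inv m z) < card (Inv m w - Inv m v)"
        using new Inv_z by (intro psubset_card_mono) (auto simp: finite_Inv)
      show "Inv m z \<subseteq> Inv m w" using Inv_z new sub by auto
    qed
    ultimately show ?thesis by (rule converse_rtrancl_into_rtrancl)
  qed simp
qed

lemma left_weak_order_iff:
  "(v, w) \<in> left_weak_order m \<longleftrightarrow>
     v permutes {1..m} \<and> w permutes {1..m} \<and> Inv m v \<subseteq> Inv m w"
  unfolding left_weak_order_def
  using left_weak_steps_Inv Inv_imp_left_weak_steps by blast

lemma weak_interval_iff:
  assumes "w permutes {1..m}"
  shows "v \<in> weak_interval m w \<longleftrightarrow> v permutes {1..m} \<and> Inv m v \<subseteq> Inv m w"
  using assms by (auto simp: weak_interval_def left_weak_order_iff)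

section \<open>The interval as a poset ranked by length\<close>

lemma left_weak_order_cases:
  assumes "(v, w) \<in> left_weak_order m"
  obtains "v = w" |
    z where "(v, z) \<in> left_weak_order m" "(z, w) \<in> left_weak_order m" "len m z = len m v + 1"
proof -
  have vw: "(v, w) \<in> (left_weak_step m)\<^sup>*" "v permutes {1..m}" "w permutes {1..m}"
    using assms by (auto simp: left_weak_order_def)
  from vw(1) show thesis
  proof (cases rule: converse_rtranclE)
    case (step z)
    then show ?thesis using vw(2,3) by (intro that(2)[of z])
      (auto simp: left_weak_order_def left_weak_step_def)
  qed (use that in auto)
qed

lemma left_weak_order_len: "(v, w) \<in> left_weak_order m \<Longrightarrow> len m v \<le> len m w"
  by (auto simp: left_weak_order_iff len_def intro!: card_mono finite_Inv)

text \<open>A nontrivial chain from \<open>v\<close> to \<open>w\<close> raises the length at its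
  first step, and no chain back to \<open>v\<close> can lower it.\<close>

lemma left_weak_order_antisym:
  assumes "(v, w) \<in> left_weak_order m" "(w, v) \<in> left_weak_order m"
  shows "v = w"
  using assms(1)
proof (cases rule: left_weak_order_cases)
  case (2 z)
  then show ?thesis
    using left_weak_order_len[OF 2(2)] left_weak_order_len[OF assms(2)] by simp
qed

lemma finite_weak_interval: "finite (weak_interval m w)"
  by (rule finite_subset[of _ "{v. v permutes {1..m}}"])
    (auto simp: weak_interval_def intro: finite_permutations)

lemma partial_order_weak_interval:
  "partial_order_on (weak_interval m w) (Restr (left_weak_order m) (weak_interval m w))"
  unfolding partial_order_on_def preorder_on_def
proof (intro conjI)
  show "refl_on (weak_interval m w) (Restr (left_weak_order m) (weak_interval m w))"
    by (auto simp: refl_on_def weak_interval_def left_weak_order_iff)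
  show "trans (Restr (left_weak_order m) (weak_interval m w))"
    by (rule transI) (auto simp: left_weak_order_iff)
  show "antisym (Restr (left_weak_order m) (weak_interval m w))"
    by (rule antisymI) (auto intro: left_weak_order_antisym)
qed auto

lemma len_id: "len m id = 0"
proof -
  have "Inv m id = {}" by (auto simp: Inv_def)
  then show ?thesis by (simp add: len_def)
qed

lemma id_in_weak_interval:
  assumes "w permutes {1..m}"
  shows "id \<in> weak_interval m w"
  using assms permutes_id by (auto simp: weak_interval_iff Inv_def)

text \<open>\<open>id\<close> lies below everything, so it is the only minimal element. The first
  step of a chain from \<open>u\<close> to \<open>v\<close> stays in the interval, so if
  \<open>v\<close> covers \<open>u\<close> that step already reaches \<open>v\<close>.\<close>

lemma rank_function_weak_interval:
  assumes w: "w permutes {1..m}"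
  shows "rank_function (weak_interval m w) (Restr (left_weak_order m) (weak_interval m w)) (len m)"
    (is "rank_function ?P ?r _")
  unfolding rank_function_def
proof (intro conjI allI impI)
  fix v assume v: "minimal_in ?P ?r v"
  then have "(id, v) \<in> ?r"
    using id_in_weak_interval[OF w] permutes_id
    by (auto simp: minimal_in_def left_weak_order_iff weak_interval_iff[OF w] Inv_def)
  then have "id = v" using v by (auto simp: minimal_in_def)
  then show "len m v = 0" using len_id by metis
next
  fix u v assume cov: "covered_by ?P ?r u v"
  then have uv: "(u, v) \<in> left_weak_order m" "u \<noteq> v" "u \<in> ?P" "v \<in> ?P"
    by (auto simp: covered_by_def)
  from uv(1) show "len m v = len m u + 1"
  proof (cases rule: left_weak_order_cases)
    case (2 z)
    then have "z \<in> ?P" using uv(4) by (auto simp: weak_interval_def left_weak_order_iff)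
    then have "z = u \<or> z = v" using cov 2 uv(3,4) by (auto simp: covered_by_def)
    then show ?thesis using 2(3) by auto
  qed (use uv in simp)
qed

section \<open>Rank-reversing bijections\<close>

lemma coeff_rank_poly:
  assumes "finite P"
  shows "coeff (rank_poly P \<rho>) k = int (card {x \<in> P. \<rho> x = k})"
proof -
  have "coeff (rank_poly P \<rho>) k = (\<Sum>x\<in>P. if \<rho> x = k then 1 else 0)"
    by (simp add: rank_poly_def coeff_sum coeff_monom)
  also have "\<dots> = int (card {x \<in> P. \<rho> x = k})"
    using assms by (simp add: sum.If_cases Int_def)
  finally show ?thesis .
qed

text \<open>\<open>f\<close> matches rank \<open>k\<close> with rank \<open>L - k\<close>. The
  element \<open>e\<close> makes the constant term nonzero, hence also the coefficient at
  \<open>L\<close>, so the degree is exactly \<open>L\<close>.\<close>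

lemma symmetric_poly_rank_poly:
  assumes fin: "finite P" and e: "e \<in> P" "\<rho> e = 0"
    and f: "bij_betw f P P" and rev: "\<And>x. x \<in> P \<Longrightarrow> \<rho> (f x) + \<rho> x = L"
  shows "symmetric_poly (rank_poly P \<rho>)"
proof -
  define p where "p = rank_poly P \<rho>"
  have sym: "coeff p (L - k) = coeff p k" if "k \<le> L" for k
  proof -
    have "bij_betw f {x \<in> P. \<rho> x = k} {x \<in> P. \<rho> x = L - k}"
    proof (rule bij_betw_imageI)
      show "inj_on f {x \<in> P. \<rho> x = k}"
        using bij_betw_imp_inj_on[OF f] by (rule inj_on_subset) auto
      show "f ` {x \<in> P. \<rho> x = k} = {x \<in> P. \<rho> x = L - k}"
      proof (intro equalityI subsetI)
        fix y assume "y \<in> f ` {x \<in> P. \<rho> x = k}"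
        then show "y \<in> {x \<in> P. \<rho> x = L - k}"
          using bij_betw_imp_surj_on[OF f] rev by force
      next
        fix y assume y: "y \<in> {x \<in> P. \<rho> x = L - k}"
        then obtain x where "x \<in> P" "y = f x" using bij_betw_imp_surj_on[OF f] by blast
        then show "y \<in> f ` {x \<in> P. \<rho> x = k}" using rev[of x] y that by auto
      qed
    qed
    then show ?thesis unfolding p_def coeff_rank_poly[OF fin] using bij_betw_same_card by fastforce
  qed
  have p0: "coeff p 0 \<noteq> 0"
    using fin e unfolding p_def coeff_rank_poly[OF fin] by auto
  have "coeff p k = 0" if "k > L" for k
  proof -
    have "{x \<in> P. \<rho> x = k} = {}" using rev that by fastforce
    then show ?thesis by (simp only: p_def coeff_rank_poly[OF fin] card.empty of_nat_0)
  qed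
  moreover have "coeff p L \<noteq> 0" using sym[of 0] p0 by simp
  ultimately have deg: "degree p = L"
    by (meson le_antisym degree_le le_degree)
  have "reflect_poly p = p"
    by (rule poly_eqI) (use sym deg in \<open>auto simp: coeff_reflect_poly coeff_eq_0\<close>)
  \<comment> \<open>\<open>coeffs_reflect_poly\<close> strips zeros at the low end before reversing;
    the nonzero constant term leaves none to strip.\<close>
  moreover have "dropWhile ((=) 0) (coeffs p) = coeffs p"
    using p0 by (cases p) (auto simp: cCons_def)
  ultimately have "coeffs p = rev (coeffs p)"
    using coeffs_reflect_poly[of p] by simp
  then show ?thesis by (simp add: symmetric_poly_def p_def)
qed

lemma weak_interval_rank_symmetricI:
  assumes w: "w permutes {1..m}"
    and into: "\<And>v. v \<in> weak_interval m w \<Longrightarrow> f v \<in> weak_interval m w"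
    and invol: "\<And>v. v \<in> weak_interval m w \<Longrightarrow> f (f v) = v"
    and len: "\<And>v. v \<in> weak_interval m w \<Longrightarrow> len m (f v) + len m v = len m w"
  shows "weak_interval_rank_symmetric m w"
proof -
  have "bij_betw f (weak_interval m w) (weak_interval m w)"
    by (rule bij_betw_byWitness[where f' = f]) (use into invol in auto)
  then have "symmetric_poly (rank_poly (weak_interval m w) (len m))"
    using len finite_weak_interval id_in_weak_interval[OF w] len_id
    by (intro symmetric_poly_rank_poly[where e = id]) auto
  then show ?thesis
    unfolding weak_interval_rank_symmetric_def rank_symmetric_def
    using finite_weak_interval partial_order_weak_interval rank_function_weak_interval[OF w]
    by blast
qed

section \<open>Block permutations\<close>

text \<open>Pigeonhole: if \<open>v i > c\<close> for some \<open>i \<le> c\<close>, the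
  \<open>m - c\<close> values at positions beyond \<open>c\<close> would all have to fit above
  \<open>v i\<close>.\<close>

lemma permutes_initial_segment:
  fixes v :: "nat \<Rightarrow> nat"
  assumes v: "v permutes {1..m}"
    and less: "\<And>i j. 1 \<le> i \<Longrightarrow> i \<le> c \<Longrightarrow> c < j \<Longrightarrow> j \<le> m \<Longrightarrow> v i < v j"
  shows "v i \<le> c \<longleftrightarrow> i \<le> c"
proof -
  have fwd: "v i \<le> c" if "i \<le> c" for i
  proof (rule ccontr)
    assume vi: "\<not> v i \<le> c"
    then have i: "i \<in> {1..m}" using that permutes_not_in[OF v, of i] by metis
    have "v ` {c<..m} \<subseteq> {Suc (v i)..m}"
    proof
      fix y assume "y \<in> v ` {c<..m}"
      then obtain j where "c < j" "j \<le> m" "y = v j" by auto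
      then show "y \<in> {Suc (v i)..m}"
        using less[of i j] i that permutes_in_image[OF v, of j] by auto
    qed
    then have "card (v ` {c<..m}) \<le> card {Suc (v i)..m}" by (intro card_mono) auto
    moreover have "card (v ` {c<..m}) = m - c"
      using permutes_inj_on[OF v] by (simp add: card_image)
    moreover have "v i \<le> m" using permutes_in_image[OF v, of i] i by auto
    ultimately show False using vi by simp
  qed
  have "v ` {..c} = {..c}"
    using fwd permutes_inj_on[OF v] by (intro endo_inj_surj) auto
  then show ?thesis
    using fwd permutes_inj[OF v] by (metis atMost_iff imageE injD)
qed

text \<open>Each point beyond \<open>2 * n\<close> is a block of its own, so preserving blocks
  forces it to be fixed. The labels increase weakly, so blocks can be compared by order.\<close>

definition block :: "nat \<Rightarrow> nat \<Rightarrow> nat" where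
  "block n i = (if i \<le> n then 0 else if i \<le> 2 * n then 1 else i)"

definition block_swap :: "nat \<Rightarrow> nat \<Rightarrow> nat" where
  "block_swap n i =
     (if 1 \<le> i \<and> i \<le> n then i + n else if n < i \<and> i \<le> 2 * n then i - n else i)"

lemma block_swap_block_swap: "block_swap n (block_swap n i) = i"
  by (auto simp: block_swap_def)

lemma block_swap_permutes:
  assumes "2 * n \<le> m"
  shows "block_swap n permutes {1..m}"
proof (rule bij_imp_permutes)
  show "bij_betw (block_swap n) {1..m} {1..m}"
    by (rule bij_betw_byWitness[where f' = "block_swap n"])
      (use assms in \<open>auto simp: block_swap_block_swap block_swap_def\<close>)
qed (use assms in \<open>auto simp: block_swap_def\<close>)

lemma block_swap_less_iff:
  assumes "block n i = block n j" "i \<ge> 1" "j \<ge> 1"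
  shows "block_swap n i < block_swap n j \<longleftrightarrow> i < j"
  using assms by (auto simp: block_def block_swap_def split: if_splits)

text \<open>The point 0 shares its label with \<open>1, ..., n\<close> but is not moved with them,
  hence the restriction to positive points.\<close>

lemma block_block_swap:
  assumes "i \<ge> 1" "j \<ge> 1"
  shows "block n (block_swap n i) = block n (block_swap n j) \<longleftrightarrow> block n i = block n j"
  using assms by (auto simp: block_def block_swap_def split: if_splits)

lemma block_mono: "i \<le> j \<Longrightarrow> block n i \<le> block n j"
  by (auto simp: block_def)

text \<open>Monotone labels give \<open>block n i \<le> block n j = block n (f j) \<le> block n (f
  i) = block n i\<close>.\<close>

lemma block_eq_of_Inv:
  assumes "\<And>i. block n (f i) = block n i" "(i, j) \<in> Inv m f"
  shows "block n i = block n j"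
  using InvD[OF assms(2)] assms(1)[of i] assms(1)[of j] block_mono[of i j n]
    block_mono[of "f j" "f i" n] by simp

lemma block_preserved_of_Inv:
  assumes v: "v permutes {1..m}"
    and blk: "\<And>i j. (i, j) \<in> Inv m v \<Longrightarrow> block n i = block n j"
  shows "block n (v i) = block n i"
proof -
  \<comment> \<open>These \<open>c\<close> are the block boundaries: no inversion crosses them, so
    \<open>v\<close> preserves the initial segment up to \<open>c\<close>. Consecutive cuts
    \<open>i - 1\<close> and \<open>i\<close> then pin each point beyond
    \<open>2 * n\<close>.\<close>
  have cut: "v i \<le> c \<longleftrightarrow> i \<le> c" if c: "c = n \<or> c \<ge> 2 * n" for i c
  proof (rule permutes_initial_segment[OF v])
    fix i j assume ij: "1 \<le> i" "i \<le> c" "c < j" "j \<le> m"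
    then have "block n i \<noteq> block n j" using c by (auto simp: block_def)
    then have "(i, j) \<notin> Inv m v" using blk by blast
    then have "v i \<le> v j" using ij by (auto simp: Inv_def)
    moreover have "v i \<noteq> v j" using ij(2,3) permutes_inj[OF v] by (metis injD not_le)
    ultimately show "v i < v j" by simp
  qed
  have "v i = i" if "i > 2 * n"
  proof -
    have "v i \<le> i" using cut[of i i] that by simp
    moreover have "2 * n \<le> i - 1" "\<not> i \<le> i - 1" using that by simp_all
    then have "\<not> v i \<le> i - 1" using cut[of "i - 1" i] by blast
    ultimately show ?thesis by simp
  qed
  then show ?thesis using cut[of n i] cut[of "2 * n" i] by (auto simp: block_def)
qed

section \<open>The interval below \<open>w \<oplus> w\<^sup>-\<^sup>1\<close>\<close>

lemma block_perm_oplus: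
  assumes v: "v permutes {1..n}" and w: "w permutes {1..n}"
  shows "block n (perm_oplus n v w i) = block n i"
proof -
  have v_le: "v i \<le> n \<longleftrightarrow> i \<le> n" for i
    using permutes_in_image[OF v, of i] permutes_not_in[OF v, of i] by (cases "i \<in> {1..n}") auto
  have w_le: "w i \<le> n \<longleftrightarrow> i \<le> n" and w_0: "w i = 0 \<longleftrightarrow> i = 0" for i
    using permutes_in_image[OF w, of i] permutes_not_in[OF w, of i] by (cases "i \<in> {1..n}"; auto)+
  show ?thesis
    using v_le[of i] w_le[of "i - n"] w_0[of "i - n"] permutes_not_in[OF w, of "i - n"]
    by (auto simp: block_def perm_oplus_def)
qed

text \<open>Conjugation by the swap exchanges the summands \<open>w\<close> and
  \<open>inv w\<close>, which inverts the sum. Here this is written as \<open>x t x = t\<close>,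
  free of the inverse of \<open>x\<close>.\<close>

lemma perm_oplus_inv_block_swap:
  assumes w: "w permutes {1..n}"
  shows "perm_oplus n w (inv w) (block_swap n (perm_oplus n w (inv w) i)) = block_swap n i"
proof -
  have inv: "w (inv w k) = k" "inv w (w k) = k" for k using permutes_inverses[OF w] by auto
  have w_in: "w k \<in> {1..n} \<longleftrightarrow> k \<in> {1..n}" "inv w k \<in> {1..n} \<longleftrightarrow> k \<in> {1..n}" for k
    using permutes_in_image[OF w] permutes_in_image[OF permutes_inv[OF w]] by auto
  have out: "w k = k" "inv w k = k" if "k \<notin> {1..n}" for k
    using permutes_not_in[OF w that] permutes_not_in[OF permutes_inv[OF w] that] by auto
  consider "i = 0" | "i \<in> {1..n}" | "i - n \<in> {1..n}" "i > n" | "i > 2 * n" by fastforce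
  then show ?thesis
  proof cases
    case 1
    then show ?thesis using out[of 0] by (auto simp: perm_oplus_def block_swap_def)
  next
    case 2
    then show ?thesis using w_in(1)[of i] inv by (auto simp: perm_oplus_def block_swap_def)
  next
    case 3
    then show ?thesis using w_in(2)[of "i - n"] inv by (auto simp: perm_oplus_def block_swap_def)
  next
    case 4
    then have "i - n \<notin> {1..n}" by auto
    then have "inv w (i - n) = i - n" by (rule out)
    then show ?thesis using 4 by (auto simp: perm_oplus_def block_swap_def)
  qed
qed

text \<open>The hypothesis \<open>xtx\<close> says that conjugation by the block swap inverts \<open>x\<close>.\<close>

lemma weak_interval_rank_symmetric_block:
  assumes x: "x permutes {1..m}" and mn: "2 * n \<le> m"
    and blk_x: "\<And>i. block n (x i) = block n i"
    and xtx: "\<And>i. x (block_swap n (x i)) = block_swap n i"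
  shows "weak_interval_rank_symmetric m x"
proof -
  define t where "t = block_swap n"
  define \<phi> where "\<phi> v = t \<circ> v \<circ> inv x \<circ> t" for v
  have t: "t permutes {1..m}" unfolding t_def by (rule block_swap_permutes[OF mn])
  have tt: "t (t i) = i" for i by (simp add: t_def block_swap_block_swap)
  have xtx': "x (t (x i)) = t i" for i using xtx by (simp add: t_def)
  have xi: "x (inv x i) = i" "inv x (x i) = i" for i using permutes_inverses[OF x] by auto
  \<comment> \<open>Every point has the form \<open>t (x i)\<close>, and in these coordinates
    \<open>\<phi> v\<close> needs no inverse.\<close>
  have \<phi>_tx: "\<phi> v (t (x i)) = t (v i)" for v i by (simp add: \<phi>_def tt xi)
  have pos: "f i \<ge> 1" if "f permutes {1..m}" "i \<ge> 1" for f :: "nat \<Rightarrow> nat" and i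
    using permutes_in_image[OF that(1), of i] permutes_not_in[OF that(1), of i] that(2)
    by (cases "i \<in> {1..m}") auto
  have key: "\<phi> v permutes {1..m} \<and> Inv m (\<phi> v) \<subseteq> Inv m x \<and>
      len m (\<phi> v) + len m v = len m x"
    if v: "v permutes {1..m}" and sub: "Inv m v \<subseteq> Inv m x" for v
  proof -
    have perm: "\<phi> v permutes {1..m}"
      unfolding \<phi>_def by (intro permutes_compose t permutes_inv[OF x] v)
    \<comment> \<open>Inversions of \<open>v\<close> are inversions of \<open>x\<close>, hence lie
      within blocks; this is the splitting of \<open>v\<close> into a direct sum.\<close>
    have blk_v: "block n (v i) = block n i" for i
      using sub block_eq_of_Inv[OF blk_x] by (intro block_preserved_of_Inv[OF v]) blast
    have blk_ix: "block n (inv x i) = block n i" for i using blk_x[of "inv x i"] xi by simp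
    have blk_\<phi>: "block n (\<phi> v i) = block n i" for i
    proof (cases "i = 0")
      case True
      then show ?thesis using permutes_not_in[OF perm, of i] by simp
    next
      case False
      then have "i \<ge> 1" by simp
      then have ge: "t i \<ge> 1" "v (inv x (t i)) \<ge> 1"
        using pos[OF t] pos[OF v] pos[OF permutes_inv[OF x]] by blast+
      have "block n (v (inv x (t i))) = block n (t i)" using blk_v blk_ix by simp
      then have "block n (t (v (inv x (t i)))) = block n (t (t i))"
        using block_block_swap[OF ge(2,1)] by (simp add: t_def)
      then show ?thesis by (simp add: \<phi>_def tt)
    qed
    \<comment> \<open>A pair inverted by \<open>x\<close> but not by \<open>v\<close> is a pair of positions whose \<open>x\<close>-values are
      inverted by \<open>v x\<^sup>-\<^sup>1\<close>; within a block \<open>t\<close> preserves the order.\<close>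
    define g where "g = (\<lambda>(a, b). (t (x b), t (x a)))"
    have bij: "g ` (Inv m x - Inv m v) = Inv m (\<phi> v)"
    proof (intro equalityI subsetI)
      fix p assume "p \<in> g ` (Inv m x - Inv m v)"
      then obtain a b where ab: "(a, b) \<in> Inv m x" "(a, b) \<notin> Inv m v"
        and p: "p = (t (x b), t (x a))" by (auto simp: g_def)
      note ab' = InvD[OF ab(1)]
      have same: "block n a = block n b" by (rule block_eq_of_Inv[OF blk_x ab(1)])
      have vab: "v a < v b"
      proof -
        have "v a \<noteq> v b" using ab'(3) permutes_inj[OF v] by (metis injD less_irrefl)
        moreover have "\<not> v a > v b" using ab(2) ab'(1-3) by (auto simp: Inv_def)
        ultimately show ?thesis by simp
      qed
      have "t (x b) < t (x a)"
        unfolding t_def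
        using same blk_x ab' pos[OF x] by (subst block_swap_less_iff) auto
      moreover have "t (v a) < t (v b)"
        unfolding t_def
        using same blk_v ab' pos[OF v] vab by (subst block_swap_less_iff) auto
      moreover have "t (x b) \<in> {1..m}" "t (x a) \<in> {1..m}"
        using ab' permutes_in_image[OF t] permutes_in_image[OF x] by blast+
      ultimately show "p \<in> Inv m (\<phi> v)" by (simp add: p Inv_def \<phi>_tx)
    next
      fix p assume "p \<in> Inv m (\<phi> v)"
      then obtain i j where p: "p = (i, j)" and ij: "(i, j) \<in> Inv m (\<phi> v)" by (cases p) auto
      note ij' = InvD[OF ij]
      define a where "a = inv x (t j)"
      define b where "b = inv x (t i)"
      have i: "i = t (x b)" and j: "j = t (x a)" by (simp_all add: a_def b_def xi tt)
      have ab: "a \<in> {1..m}" "b \<in> {1..m}"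
        unfolding a_def b_def
        using ij' permutes_in_image[OF t] permutes_in_image[OF permutes_inv[OF x]] by blast+
      have "block n i = block n j" by (rule block_eq_of_Inv[OF blk_\<phi> ij])
      then have same: "block n (x a) = block n (x b)"
        using ab pos[OF x] block_block_swap[of "x a" "x b" n] by (auto simp: i j t_def)
      then have same': "block n (v a) = block n (v b)" by (simp add: blk_x blk_v)
      have xab: "x b < x a"
        using ij'(3) same ab pos[OF x] unfolding i j t_def by (subst (asm) block_swap_less_iff) auto
      have vab: "v a < v b"
        using ij'(4) same' ab pos[OF v] unfolding i j \<phi>_tx unfolding t_def
        by (subst (asm) block_swap_less_iff) auto
      \<comment> \<open>If \<open>b < a\<close>, then \<open>(b, a)\<close> is inverted by
        \<open>v\<close> and so by \<open>x\<close>, against \<open>xab\<close>.\<close>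
      have "a < b"
      proof (rule ccontr)
        assume "\<not> a < b"
        then have "b < a" using xab by (metis linorder_neqE_nat less_irrefl)
        then have "(b, a) \<in> Inv m v" using vab ab by (auto simp: Inv_def)
        then show False using sub InvD(4)[of b a m x] xab by auto
      qed
      then have "(a, b) \<in> Inv m x - Inv m v" using ab xab vab by (auto simp: Inv_def)
      then show "p \<in> g ` (Inv m x - Inv m v)" by (force simp: p g_def i j)
    qed
    have "inj_on g (Inv m x - Inv m v)"
      using permutes_inj[OF t] permutes_inj[OF x] by (auto simp: g_def inj_on_def dest!: injD)
    then have "len m (\<phi> v) = card (Inv m x - Inv m v)"
      unfolding len_def bij[symmetric] by (rule card_image)
    also have "\<dots> = len m x - len m v"
      unfolding len_def using sub by (intro card_Diff_subset finite_Inv)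
    finally have "len m (\<phi> v) + len m v = len m x"
      using card_mono[OF finite_Inv sub] by (simp add: len_def)
    moreover have "Inv m (\<phi> v) \<subseteq> Inv m x"
    proof
      fix p assume "p \<in> Inv m (\<phi> v)"
      moreover from this have "p \<in> g ` (Inv m x - Inv m v)" by (simp only: bij)
      then obtain a b where ab: "(a, b) \<in> Inv m x" and p: "p = (t (x b), t (x a))"
        by (auto simp: g_def)
      \<comment> \<open>By \<open>xtx'\<close> the values of \<open>x\<close> at
        \<open>t (x b)\<close> and \<open>t (x a)\<close> are \<open>t b\<close> and
        \<open>t a\<close>.\<close>
      have "t a < t b"
        unfolding t_def using block_eq_of_Inv[OF blk_x ab] InvD[OF ab]
        by (subst block_swap_less_iff) auto
      ultimately show "p \<in> Inv m x" by (auto simp: p Inv_def xtx')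
    qed
    ultimately show ?thesis using perm by blast
  qed
  have invol: "\<phi> (\<phi> v) = v" for v
  proof
    fix i
    \<comment> \<open>Twice \<open>\<phi>\<close> gives
      \<open>v \<circ> inv x \<circ> t \<circ> inv x \<circ> t\<close>; replacing the first
      \<open>inv x \<circ> t\<close> by \<open>t \<circ> x\<close> cancels everything after
      \<open>v\<close>.\<close>
    have "inv x (t i) = t (x i)" using xtx'[of i] xi by metis
    then show "\<phi> (\<phi> v) i = v i" by (simp add: \<phi>_def tt xi)
  qed
  show ?thesis
    by (rule weak_interval_rank_symmetricI[OF x, where f = \<phi>])
      (use key invol in \<open>auto simp: weak_interval_iff[OF x]\<close>)
qed

text \<open>Allowing \<open>m\<close> to exceed \<open>2 * n\<close> covers the count for odd degree
  as well, where one further point is fixed.\<close>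

lemma weak_interval_rank_symmetric_perm_oplus:
  assumes w: "w permutes {1..n}" and mn: "2 * n \<le> m"
  shows "weak_interval_rank_symmetric m (perm_oplus n w (inv w))"
proof (rule weak_interval_rank_symmetric_block[OF _ mn])
  show "perm_oplus n w (inv w) permutes {1..m}"
    using perm_oplus_permutes[OF w permutes_inv[OF w]] by (rule permutes_subset) (use mn in auto)
qed (use block_perm_oplus[OF w permutes_inv[OF w]] perm_oplus_inv_block_swap[OF w] in auto)

theorem proposition5p2:
  fixes n :: nat
  assumes "n \<ge> 1"
  shows "(\<forall>w. w permutes {1..n} \<longrightarrow>
            weak_interval_rank_symmetric (2 * n) (perm_oplus n w (inv w))) \<and>
         fact (n div 2) \<le> card {w. w permutes {1..n} \<and> weak_interval_rank_symmetric n w}"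
proof (intro conjI allI impI)
  fix w assume "w permutes {1..n}"
  then show "weak_interval_rank_symmetric (2 * n) (perm_oplus n w (inv w))"
    by (rule weak_interval_rank_symmetric_perm_oplus) simp
next
  define k where "k = n div 2"
  have kn: "2 * k \<le> n" by (simp add: k_def)
  define h where "h w = perm_oplus k w (inv w)" for w
  have "inj_on h {w. w permutes {1..k}}"
  proof (rule inj_onI)
    fix v w assume v: "v \<in> {w. w permutes {1..k}}" and w: "w \<in> {w. w permutes {1..k}}" and "h v = h w"
    \<comment> \<open>The first summand of \<open>h v\<close> is \<open>v\<close> itself, so
      \<open>v\<close> can be read off the initial entries.\<close>
    then have "v i = w i" if "i \<le> k" for i
      using that by (auto simp: h_def perm_oplus_def dest: fun_cong[of _ _ i])
    moreover have "v i = w i" if "\<not> i \<le> k" for i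
      using that v w by (auto simp: permutes_not_in)
    ultimately show "v = w" by blast
  qed
  moreover have "h ` {w. w permutes {1..k}} \<subseteq>
      {w. w permutes {1..n} \<and> weak_interval_rank_symmetric n w}"
  proof (intro image_subsetI CollectI conjI)
    fix w assume "w \<in> {w. w permutes {1..k}}"
    then have w: "w permutes {1..k}" by simp
    show "h w permutes {1..n}"
      unfolding h_def using perm_oplus_permutes[OF w permutes_inv[OF w]] kn
      by (auto intro: permutes_subset)
    show "weak_interval_rank_symmetric n (h w)"
      unfolding h_def by (rule weak_interval_rank_symmetric_perm_oplus[OF w kn])
  qed
  moreover have "finite {w. w permutes {1..n} \<and> weak_interval_rank_symmetric n w}"
    by (rule finite_subset[OF _ finite_permutations[of "{1..n}"]]) auto
  ultimately have "card {w. w permutes {1..k}} \<le>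
      card {w. w permutes {1..n} \<and> weak_interval_rank_symmetric n w}"
    by (rule card_inj_on_le)
  then show "fact (n div 2) \<le> card {w. w permutes {1..n} \<and> weak_interval_rank_symmetric n w}"
    by (simp add: card_permutations[of _ k] k_def)
qed

end
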